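(* Let $p\in[1,\infty]$ and let $X$ be a non-empty set whose elements are finite subsets of some universe. Define $d^p:X\times X\to\mathbb{R}$ by $$d^p(A,B)=\big(|A\setminus B|^p+|B\setminus A|^p\big)^{1/p}$$ (for $p=\infty$, $d^\infty(A,B)=\max(|A\setminus B|,|B\setminus A|)$). Then $(X,d^p)$ is a metric space.
   Context: $|\cdot|$ denotes the cardinality of a finite set and $A\setminus B=A\cap B^c$. A metric $d$ on $X$ is a real-valued function that is nonnegative, symmetric, satisfies $d(a,b)=0\iff a=b$, and satisfies the triangle inequality. *)

theory Defs
  imports "HOL-Analysis.Abstract_Metric_Spaces" "HOL-Library.Extended_Real"
begin

(* The exponent is an extended real so that p = \<infinity> is an ordinary value of the parameter.
   Since 0 powr r = 0 for every r, powr agrees with the usual power at base 0 for 1 \<le> p < \<infinity>.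
   Only finite A and B are meaningful, because card is 0 on infinite sets. *)
definition set_dist :: "ereal \<Rightarrow> 'a set \<Rightarrow> 'a set \<Rightarrow> real" where
  "set_dist p A B =
     (if p = \<infinity> then max (real (card (A - B))) (real (card (B - A)))
      else (real (card (A - B)) powr real_of_ereal p
              + real (card (B - A)) powr real_of_ereal p) powr (1 / real_of_ereal p))"

end

theory Submission
  imports Defs "HOL-Analysis.Convex"
begin

text \<open>
  The value \<open>d\<^sup>p(A, B)\<close> is the \<open>\<ell>\<^sup>p\<close> norm of the vector \<open>(|A \ B|, |B \ A|)\<close>. Since
  \<open>A \ C \<subseteq> (A \ B) \<union> (B \ C)\<close> and likewise with \<open>A\<close> and \<open>C\<close> exchanged, this vector is subadditive
  in each component, so the triangle inequality follows from monotonicity of the norm and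
  Minkowski's inequality in the plane. The latter is convexity of \<open>x \<mapsto> x\<^sup>p\<close> applied to the
  normalised vectors.
\<close>

text \<open>The endpoint 0 is included because \<open>card (A - B)\<close> may vanish; away from it
  this is \<open>powr_convex\<close>.\<close>

lemma powr_convex_nonneg:
  fixes p :: real
  assumes "p \<ge> 1"
  shows "convex_on {0..} (\<lambda>x. x powr p)"
proof (rule convex_onI)
  \<comment> \<open>If one point is 0, convexity reduces to this bound, which holds since
    \<open>u powr p \<le> u\<close> for \<open>0 < u < 1\<close> and
    \<open>p \<ge> 1\<close>.\<close>
  have contract: "(u * x) powr p \<le> u * x powr p" if "0 < u" "u < 1" "0 \<le> x" for u x :: real
    using that assms powr_mono'[of 1 p u] by (simp add: powr_mult mult_right_mono)
  fix t x y :: real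
  assume t: "0 < t" "t < 1" and xy: "x \<in> {0..}" "y \<in> {0..}"
  show "((1 - t) *\<^sub>R x + t *\<^sub>R y) powr p \<le> (1 - t) * x powr p + t * y powr p"
  proof (cases "x = 0 \<or> y = 0")
    case True
    then show ?thesis
      using contract[of t y] contract[of "1 - t" x] t xy assms by auto
  next
    case False
    then show ?thesis
      using convex_onD[OF powr_convex[OF assms], of t x y] t xy by simp
  qed
qed simp

lemma Minkowski_inequality_plane:
  fixes p a b c d :: real
  assumes p: "p \<ge> 1" and nonneg: "0 \<le> a" "0 \<le> b" "0 \<le> c" "0 \<le> d"
  shows "((a + c) powr p + (b + d) powr p) powr (1 / p)
    \<le> (a powr p + b powr p) powr (1 / p) + (c powr p + d powr p) powr (1 / p)"
proof -
  define s where "s = (a powr p + b powr p) powr (1 / p)"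
  define t where "t = (c powr p + d powr p) powr (1 / p)"
  have sp: "s powr p = a powr p + b powr p" and tp: "t powr p = c powr p + d powr p"
    using p by (simp_all add: s_def t_def powr_powr)
  have s0: "a = 0 \<and> b = 0" if "s = 0"
    using sp that p nonneg by (simp add: add_nonneg_eq_0_iff)
  have t0: "c = 0 \<and> d = 0" if "t = 0"
    using tp that p nonneg by (simp add: add_nonneg_eq_0_iff)
  \<comment> \<open>A vector of norm 0 cannot be normalised, but it is the zero vector, and then
    both sides agree.\<close>
  consider "s = 0" | "t = 0" | "0 < s" "0 < t"
    by (fastforce simp: s_def t_def)
  then have "((a + c) powr p + (b + d) powr p) powr (1 / p) \<le> s + t"
  proof cases
    case 1
    then show ?thesis using s0 p by (simp add: t_def)
  next
    case 2
    then show ?thesis using t0 p by (simp add: s_def)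
  next
    case 3
    \<comment> \<open>With these weights the sum divided by \<open>s + t\<close> is a convex
      combination of the unit vectors \<open>(a / s, b / s)\<close> and
      \<open>(c / t, d / t)\<close>, because
      \<open>s / (s + t) * (x / s) = x / (s + t)\<close>.\<close>
    define r where "r = t / (s + t)"
    have r: "0 \<le> r" "r \<le> 1" and r': "1 - r = s / (s + t)"
      using 3 by (simp_all add: r_def field_simps)
    have comp: "((x + y) / (s + t)) powr p
        \<le> (1 - r) * (x powr p / s powr p) + r * (y powr p / t powr p)"
      if "0 \<le> x" "0 \<le> y" for x y
    proof -
      have "(x + y) / (s + t) = (1 - r) *\<^sub>R (x / s) + r *\<^sub>R (y / t)"
        unfolding r' using 3 by (simp add: r_def add_divide_distrib)
      then show ?thesis
        using convex_onD[OF powr_convex_nonneg[OF p] r, of "x / s" "y / t"] that 3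
        by (simp add: powr_divide)
    qed
    have "((a + c) powr p + (b + d) powr p) / (s + t) powr p
        = ((a + c) / (s + t)) powr p + ((b + d) / (s + t)) powr p"
      unfolding powr_divide by (rule add_divide_distrib)
    also have "\<dots> \<le> (1 - r) * ((a powr p + b powr p) / s powr p)
        + r * ((c powr p + d powr p) / t powr p)"
      using comp[of a c] comp[of b d] nonneg by (simp add: add_divide_distrib distrib_left)
    \<comment> \<open>By \<open>sp\<close> and \<open>tp\<close> both quotients are 1, and the
      weights sum to 1.\<close>
    also have "\<dots> = 1"
      using 3 by (simp flip: sp tp)
    finally have "(a + c) powr p + (b + d) powr p \<le> (s + t) powr p"
      using 3 by (simp add: divide_le_eq)
    then have "((a + c) powr p + (b + d) powr p) powr (1 / p) \<le> ((s + t) powr p) powr (1 / p)"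
      using p by (intro powr_mono2) auto
    also have "\<dots> = s + t"
      using 3 p by (simp add: powr_powr)
    finally show ?thesis .
  qed
  then show ?thesis
    by (simp add: s_def t_def)
qed

text \<open>An infinite difference on the right would count as 0 and could break the bound; finite
  \<open>A\<close> and \<open>B\<close> exclude this.\<close>

lemma card_Diff_triangle:
  assumes "finite A" "finite B"
  shows "card (A - C) \<le> card (A - B) + card (B - C)"
proof -
  have "card (A - C) \<le> card ((A - B) \<union> (B - C))"
    using assms by (intro card_mono) auto
  also have "\<dots> \<le> card (A - B) + card (B - C)"
    by (rule card_Un_le)
  finally show ?thesis .
qed

lemma set_dist_triangle:
  assumes p: "1 \<le> p" and fin: "finite A" "finite B" "finite C"
  shows "set_dist p A C \<le> set_dist p A B + set_dist p B C"
proof -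
  have AC: "real (card (A - C)) \<le> real (card (A - B)) + real (card (B - C))"
    using card_Diff_triangle[OF fin(1,2), of C] by linarith
  \<comment> \<open>The summands are ordered so that the first ones in \<open>AC\<close> and
    \<open>CA\<close> form the vector of the pair \<open>A\<close>, \<open>B\<close> and the second
    ones that of \<open>B\<close>, \<open>C\<close>.\<close>
  have CA: "real (card (C - A)) \<le> real (card (B - A)) + real (card (C - B))"
    using card_Diff_triangle[OF fin(3,2), of A] by linarith
  show ?thesis
  proof (cases p)
    case (real q)
    with p have q: "1 \<le> q" by simp
    have "(real (card (A - C)) powr q + real (card (C - A)) powr q) powr (1 / q)
      \<le> ((real (card (A - B)) + real (card (B - C))) powr q
          + (real (card (B - A)) + real (card (C - B))) powr q) powr (1 / q)"
      using q AC CA by (intro powr_mono2 add_mono) auto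
    also have "\<dots> \<le> (real (card (A - B)) powr q + real (card (B - A)) powr q) powr (1 / q)
        + (real (card (B - C)) powr q + real (card (C - B)) powr q) powr (1 / q)"
      using q by (intro Minkowski_inequality_plane) auto
    finally show ?thesis
      by (simp add: set_dist_def real)
  next
    case PInf
    then show ?thesis
      using AC CA by (simp add: set_dist_def max_def)
  next
    case MInf
    then show ?thesis using p by simp
  qed
qed

lemma set_dist_eq_0_iff:
  assumes p: "1 \<le> p" and fin: "finite A" "finite B"
  shows "set_dist p A B = 0 \<longleftrightarrow> A = B"
proof -
  have "set_dist p A B = 0 \<longleftrightarrow> card (A - B) = 0 \<and> card (B - A) = 0"
  proof (cases p)
    case (real q)
    with p show ?thesis
      by (simp add: set_dist_def add_nonneg_eq_0_iff)
  next
    case PInf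
    then show ?thesis
      by (auto simp: set_dist_def max_def)
  next
    case MInf
    then show ?thesis using p by simp
  qed
  \<comment> \<open>Finiteness turns cardinality 0 into an empty difference, which gives both
    inclusions.\<close>
  also have "\<dots> \<longleftrightarrow> A = B"
    using fin by auto
  finally show ?thesis .
qed

theorem theorem3p1:
  fixes p :: ereal and X :: "'a set set"
  assumes "p \<in> {1..\<infinity>}"
    and "X \<noteq> {}"
    and "\<And>A. A \<in> X \<Longrightarrow> finite A"
  shows "Metric_space X (set_dist p)"
proof
  have p: "1 \<le> p" using assms(1) by simp
  \<comment> \<open>\<open>Metric_space\<close> asks for nonnegativity and symmetry also outside
    \<open>X\<close>; both follow from the shape of the formula alone.\<close>
  show "0 \<le> set_dist p A B" for A B :: "'a set"
    by (simp add: set_dist_def le_max_iff_disj)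
  show "set_dist p A B = set_dist p B A" for A B :: "'a set"
    by (simp add: set_dist_def max.commute add.commute)
  show "set_dist p A B = 0 \<longleftrightarrow> A = B" if "A \<in> X" "B \<in> X" for A B
    using set_dist_eq_0_iff[OF p] assms(3) that by blast
  show "set_dist p A C \<le> set_dist p A B + set_dist p B C"
    if "A \<in> X" "B \<in> X" "C \<in> X" for A B C
    using set_dist_triangle[OF p] assms(3) that by blast
qed

end
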